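(* Let $(V,\|\cdot\|)$ be a normed vector space, let $H$ be a subgroup of the group of norm-preserving linear automorphisms of $V$, and let $L:H\to\mathbb{R}$ be a group-norm on $H$. Define $d_L:V\times V\to\mathbb{R}$ by $$d_L(u,v)=\inf_{a\in H}\sqrt{L^2(a)+\|u-av\|^2}.$$ Then $(V,H,L)$ is a holonomic space if and only if $d_L$ is locally isometric to the usual distance on $V$ via the identity map; that is, if and only if for every $u\in V$ there is $r>0$ such that $d_L(v,w)=\|v-w\|$ for all $v,w\in V$ with $\|v-u\|<r$ and $\|w-u\|<r$.
   Context: A group-norm on a group $G$ is a function $N:G\to\mathbb{R}$ such that $N(A)\ge 0$; $N(A)=0$ if and only if $A$ is the identity; $N(A^{-1})=N(A)$; and $N(AB)\le N(A)+N(B)$, for all $A,B\in G$. A triplet $(V,H,L)$, with $V$ a normed vector space, $H$ a subgroup of the group of norm-preserving linear automorphisms of $V$, and $L$ a group-norm on $H$, is a holonomic space if: for all $u\in V$ there exists $r>0$ such that for all $v,w\in V$ with $\|v-u\|<r$, $\|w-u\|<r$, and all $A\in H$, $$\|v-w\|^2-\|v-Aw\|^2\le L^2(A).$$ *)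

theory Defs
  imports "HOL-Analysis.Analysis" "HOL-Algebra.Group"
begin

locale group_norm = group G for G (structure) +
  fixes N :: "'a \<Rightarrow> real"
  assumes nonneg: "A \<in> carrier G \<Longrightarrow> N A \<ge> 0"
    and eq_zero_iff: "A \<in> carrier G \<Longrightarrow> N A = 0 \<longleftrightarrow> A = \<one>"
    and inv_eq: "A \<in> carrier G \<Longrightarrow> N (inv\<^bsub>G\<^esub> A) = N A"
    and subadditive: "A \<in> carrier G \<Longrightarrow> B \<in> carrier G \<Longrightarrow> N (A \<otimes> B) \<le> N A + N B"

definition linear_isometry_group :: "('v::real_normed_vector \<Rightarrow> 'v) monoid" where
  "linear_isometry_group =
     \<lparr>carrier = {f. linear f \<and> bij f \<and> (\<forall>x. norm (f x) = norm x)},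
      monoid.mult = (\<circ>), one = id\<rparr>"

lemma group_linear_isometry_group:
  "group (linear_isometry_group :: ('v::real_normed_vector \<Rightarrow> 'v) monoid)"
proof (rule groupI)
  fix f :: "'v \<Rightarrow> 'v"
  assume "f \<in> carrier linear_isometry_group"
  then have f: "linear f" "bij f" "\<And>x. norm (f x) = norm x"
    by (auto simp: linear_isometry_group_def)
  define g where "g = inv_into UNIV f"
  have fg: "f (g x) = x" for x
    unfolding g_def using f(2) by (simp add: bij_is_surj surj_f_inv_f)
  have gf: "g (f x) = x" for x
    unfolding g_def using f(2) by (simp add: bij_is_inj)
  have "linear g"
  proof (rule linearI)
    show "g (x + y) = g x + g y" for x y
      using gf[of "g x + g y"] by (simp add: linear_add[OF f(1)] fg)
    show "g (c *\<^sub>R x) = c *\<^sub>R g x" for c x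
      using gf[of "c *\<^sub>R g x"] by (simp add: linear_scale[OF f(1)] fg)
  qed
  moreover have "bij g"
    unfolding g_def using f(2) by (rule bij_imp_bij_inv)
  moreover have "norm (g x) = norm x" for x
    using f(3)[of "g x"] by (simp add: fg)
  ultimately have "g \<in> carrier linear_isometry_group"
    by (simp add: linear_isometry_group_def)
  then show "\<exists>g\<in>carrier linear_isometry_group.
      g \<otimes>\<^bsub>linear_isometry_group\<^esub> f = \<one>\<^bsub>linear_isometry_group\<^esub>"
    by (rule bexI[rotated]) (auto simp: linear_isometry_group_def gf)
qed (simp_all add: linear_isometry_group_def linear_compose bij_comp linear_id comp_assoc)

definition holonomic_space ::
    "('v::real_normed_vector \<Rightarrow> 'v) set \<Rightarrow> (('v \<Rightarrow> 'v) \<Rightarrow> real) \<Rightarrow> bool" where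
  "holonomic_space H L \<longleftrightarrow>
     subgroup H linear_isometry_group \<and>
     group_norm (linear_isometry_group\<lparr>carrier := H\<rparr>) L \<and>
     (\<forall>u. \<exists>r>0. \<forall>v w. norm (v - u) < r \<longrightarrow> norm (w - u) < r \<longrightarrow>
        (\<forall>A\<in>H. (norm (v - w))\<^sup>2 - (norm (v - A w))\<^sup>2 \<le> (L A)\<^sup>2))"

definition holonomic_dist ::
    "('v::real_normed_vector \<Rightarrow> 'v) set \<Rightarrow> (('v \<Rightarrow> 'v) \<Rightarrow> real) \<Rightarrow> 'v \<Rightarrow> 'v \<Rightarrow> real" where
  "holonomic_dist H L u v = (INF a\<in>H. sqrt ((L a)\<^sup>2 + (norm (u - a v))\<^sup>2))"

end

theory Submission
  imports Defs
begin

text \<open>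
  The identity of H contributes the value \<open>norm (v - w)\<close> to the infimum defining \<open>d\<^sub>L(v, w)\<close>,
  so equality of the two distances says exactly that \<open>norm (v - w)\<close> is a lower bound;
  squaring that bound gives the holonomic inequality for the same pair \<open>v, w\<close>.
\<close>

text \<open>All terms of the infimum are nonnegative, so 0 bounds them below and the real
  \<open>INF\<close> is a genuine lower bound.\<close>

lemma holonomic_dist_le:
  assumes "a \<in> H"
  shows "holonomic_dist H L v w \<le> sqrt ((L a)\<^sup>2 + (norm (v - a w))\<^sup>2)"
  unfolding holonomic_dist_def
  using assms by (intro cINF_lower bdd_belowI2[where m = 0]) auto

text \<open>The equivalence holds for each pair \<open>v\<close>, \<open>w\<close> separately, with
  no nearness condition.\<close>

lemma holonomic_dist_eq_norm_iff:
  assumes "id \<in> H" and "L id = 0"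
  shows "holonomic_dist H L v w = norm (v - w) \<longleftrightarrow>
    (\<forall>A\<in>H. (norm (v - w))\<^sup>2 - (norm (v - A w))\<^sup>2 \<le> (L A)\<^sup>2)"
proof -
  have upper: "holonomic_dist H L v w \<le> norm (v - w)"
    using holonomic_dist_le[OF assms(1), of L v w] assms(2) by simp
  have "holonomic_dist H L v w = norm (v - w) \<longleftrightarrow>
      (\<forall>A\<in>H. norm (v - w) \<le> sqrt ((L A)\<^sup>2 + (norm (v - A w))\<^sup>2))"
  proof
    assume "holonomic_dist H L v w = norm (v - w)"
    then show "\<forall>A\<in>H. norm (v - w) \<le> sqrt ((L A)\<^sup>2 + (norm (v - A w))\<^sup>2)"
      using holonomic_dist_le[of _ H L v w] by auto
  next
    assume "\<forall>A\<in>H. norm (v - w) \<le> sqrt ((L A)\<^sup>2 + (norm (v - A w))\<^sup>2)"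
    \<comment> \<open>Here \<open>id \<in> H\<close> makes the index set nonempty, as a greatest
      lower bound in the reals requires.\<close>
    then have "norm (v - w) \<le> holonomic_dist H L v w"
      unfolding holonomic_dist_def using assms(1) by (intro cINF_greatest) auto
    with upper show "holonomic_dist H L v w = norm (v - w)"
      by (rule antisym)
  qed
  also have "\<dots> \<longleftrightarrow> (\<forall>A\<in>H. (norm (v - w))\<^sup>2 - (norm (v - A w))\<^sup>2 \<le> (L A)\<^sup>2)"
  proof (rule ball_cong[OF refl])
    fix A
    have "norm (v - w) \<le> sqrt ((L A)\<^sup>2 + (norm (v - A w))\<^sup>2) \<longleftrightarrow>
        (norm (v - w))\<^sup>2 \<le> (L A)\<^sup>2 + (norm (v - A w))\<^sup>2"
      \<comment> \<open>A norm is nonnegative, hence the root of its own square; so two square roots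
        are compared.\<close>
      using real_sqrt_le_iff[of "(norm (v - w))\<^sup>2"] by simp
    then show "norm (v - w) \<le> sqrt ((L A)\<^sup>2 + (norm (v - A w))\<^sup>2) \<longleftrightarrow>
        (norm (v - w))\<^sup>2 - (norm (v - A w))\<^sup>2 \<le> (L A)\<^sup>2"
      by (simp add: algebra_simps)
  qed
  finally show ?thesis .
qed

theorem theoremA:
  fixes H :: "('v::real_normed_vector \<Rightarrow> 'v) set"
    and L :: "('v \<Rightarrow> 'v) \<Rightarrow> real"
  assumes "subgroup H linear_isometry_group"
    and "group_norm (linear_isometry_group\<lparr>carrier := H\<rparr>) L"
  shows "holonomic_space H L \<longleftrightarrow>
    (\<forall>u. \<exists>r>0. \<forall>v w. norm (v - u) < r \<longrightarrow> norm (w - u) < r \<longrightarrow>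
       holonomic_dist H L v w = norm (v - w))"
proof -
  have id_in: "id \<in> H"
    using subgroup.one_closed[OF assms(1)] by (simp add: linear_isometry_group_def)
  moreover have "L id = 0"
    using group_norm.eq_zero_iff[OF assms(2), of id] id_in
    by (simp add: linear_isometry_group_def)
  \<comment> \<open>The conditions agree pair by pair, so the same radius \<open>r\<close> serves
    both directions.\<close>
  ultimately show ?thesis
    unfolding holonomic_space_def using assms by (simp add: holonomic_dist_eq_norm_iff)
qed

end
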